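(* For every $0<\varepsilon\le 1$ and for each of the types (a), (b), (c) there exists an admissible cutoff function $\hat a$ of that type such that, for every integer $n\ge 1$, the kernel $$L_n(x,y):=\sum_{j=0}^\infty \hat a\Big(\frac{j}{n}\Big)\tilde T_j(x)\tilde T_j(y)$$ satisfies $$|L_n(x,y)|\le c\,n\exp\left\{-\frac{c'\varepsilon\, n\rho(x,y)}{[\ln(e+n\rho(x,y))]^{1+\varepsilon}}\right\},\qquad x,y\in[-1,1],$$ where $c'>0$ is an absolute constant and $c$ depends only on $\varepsilon$.
   Context: The normalized Chebyshev polynomials are $\tilde T_n(x):=\sqrt{2/\pi}\cos(n\arccos x)$ for $n\ge1$ and $\tilde T_0:=\sqrt{1/\pi}$; they form an orthonormal basis of $L^2([-1,1],(1-x^2)^{-1/2}dx)$. The distance on $[-1,1]$ is $\rho(x,y):=|\arccos x-\arccos y|$. A function $\hat a\in C^\infty[0,\infty)$ is an admissible cutoff function of type (a) if $\operatorname{supp}\hat a\subset[0,2]$ and $\hat a(t)=1$ for $t\in[0,1]$; of type (b) if $\operatorname{supp}\hat a\subset[1/2,2]$; of type (c) if $\operatorname{supp}\hat a\subset[1/2,2]$ and $|\hat a(t)|^2+|\hat a(t/2)|^2=1$ for $t\in[1,2]$. *)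

theory Defs
  imports "HOL-Analysis.Analysis"
begin

definition cheb :: "nat \<Rightarrow> real \<Rightarrow> real" where
  "cheb n x = (if n = 0 then sqrt (1 / pi) else sqrt (2 / pi) * cos (real n * arccos x))"

definition rho :: "real \<Rightarrow> real \<Rightarrow> real" where
  "rho x y = \<bar>arccos x - arccos y\<bar>"

definition smooth_nonneg :: "(real \<Rightarrow> real) \<Rightarrow> bool" where
  "smooth_nonneg f \<longleftrightarrow> (\<exists>D :: nat \<Rightarrow> real \<Rightarrow> real. D 0 = f \<and>
     (\<forall>k. \<forall>t\<ge>0. (D k has_real_derivative D (Suc k) t) (at t within {0..})))"

text \<open>Admissible cutoff functions of types (a), (b), (c). Support conditions are written
  as vanishing outside the given closed interval (within the domain [0,oo)).\<close>
definition admissible_a :: "(real \<Rightarrow> real) \<Rightarrow> bool" where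
  "admissible_a f \<longleftrightarrow> smooth_nonneg f \<and> (\<forall>t\<ge>0. t \<notin> {0..2} \<longrightarrow> f t = 0)
     \<and> (\<forall>t\<in>{0..1}. f t = 1)"

definition admissible_b :: "(real \<Rightarrow> real) \<Rightarrow> bool" where
  "admissible_b f \<longleftrightarrow> smooth_nonneg f \<and> (\<forall>t\<ge>0. t \<notin> {1/2..2} \<longrightarrow> f t = 0)"

definition admissible_c :: "(real \<Rightarrow> real) \<Rightarrow> bool" where
  "admissible_c f \<longleftrightarrow> smooth_nonneg f \<and> (\<forall>t\<ge>0. t \<notin> {1/2..2} \<longrightarrow> f t = 0)
     \<and> (\<forall>t\<in>{1..2}. \<bar>f t\<bar>^2 + \<bar>f (t/2)\<bar>^2 = 1)"

definition kernel :: "(real \<Rightarrow> real) \<Rightarrow> nat \<Rightarrow> real \<Rightarrow> real \<Rightarrow> real" where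
  "kernel f n x y = (\<Sum>j. f (real j / real n) * cheb j x * cheb j y)"

end

theory Submission
  imports Defs
begin

text \<open>
  With \<open>x = cos \<alpha>\<close> and \<open>y = cos \<beta>\<close> the kernel is a combination of the values at \<open>\<alpha> - \<beta>\<close> and
  \<open>\<alpha> + \<beta>\<close> of the trigonometric sum with coefficients \<open>f (\<bar>j\<bar> / n)\<close>.  Summing \<open>k\<close> times by
  parts bounds such a sum at \<open>t\<close> by a multiple of \<open>n (n \<bar>t\<bar> / 2) ^ (- k)\<close> times the supremum
  of the \<open>k\<close>-th derivative of the even extension of \<open>f\<close>.

  A cutoff whose \<open>k\<close>-th derivative is at most \<open>(C / \<epsilon>) ^ k k!\<close> times the product of
  \<open>ln (e + j) powr (1 + \<epsilon>)\<close> over \<open>j = 1, \<dots>, k\<close> is obtained by averaging a trapezoid over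
  infinitely many boxes whose widths \<open>\<epsilon> / (8 j ln (e + j) powr (1 + \<epsilon>))\<close> have sum
  at most \<open>1 / 2\<close> for every \<open>\<epsilon>\<close>; each box costs one difference quotient.  This is type (a).  If \<open>b\<close> is this
  bump, then \<open>sin (\<pi> / 2 (b t - b (2 t)))\<close> is of types (b) and (c), and Leibniz' rule shows that
  composition with the sine preserves the derivative bounds up to a factor \<open>C ^ k\<close>.
  Taking \<open>k\<close> to be about \<open>c \<epsilon> n \<rho> / ln (e + n \<rho>) powr (1 + \<epsilon>)\<close> gives the theorem.
\<close>

subsection \<open>Summation by parts\<close>

text \<open>Carrying all derivatives as one family lets dilations and differences act on every order
  at once.\<close>

definition deriv_seq :: "(nat \<Rightarrow> real \<Rightarrow> real) \<Rightarrow> bool" where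
  "deriv_seq D \<longleftrightarrow> (\<forall>k t. (D k has_real_derivative D (Suc k) t) (at t))"

text \<open>Differences are backward so that vanishing on negative arguments survives them; only the
  upper end of the support moves.\<close>

definition bdiff :: "(real \<Rightarrow> real) \<Rightarrow> real \<Rightarrow> real" where
  "bdiff f t = f t - f (t - 1)"

lemma deriv_seqD: "deriv_seq D \<Longrightarrow> (D k has_real_derivative D (Suc k) t) (at t)"
  by (simp add: deriv_seq_def)

lemma deriv_seq_affine:
  assumes "deriv_seq D"
  shows "deriv_seq (\<lambda>k t. a ^ k * D k (a * t + b))"
  unfolding deriv_seq_def
proof (intro allI)
  fix k t
  have "((\<lambda>t. D k (a * t + b)) has_real_derivative D (Suc k) (a * t + b) * a) (at t)"
    by (rule DERIV_chain'[OF _ deriv_seqD[OF assms]]) (auto intro!: derivative_eq_intros)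
  then have "((\<lambda>t. a ^ k * D k (a * t + b)) has_real_derivative a ^ k * (D (Suc k) (a * t + b) * a)) (at t)"
    by (rule DERIV_cmult)
  then show "((\<lambda>t. a ^ k * D k (a * t + b)) has_real_derivative
               a ^ Suc k * D (Suc k) (a * t + b)) (at t)"
    by (simp add: mult_ac)
qed

lemma deriv_seq_diff:
  "deriv_seq D \<Longrightarrow> deriv_seq E \<Longrightarrow> deriv_seq (\<lambda>k t. D k t - E k t)"
  by (auto simp: deriv_seq_def intro!: DERIV_diff)

lemma deriv_seq_cmult:
  "deriv_seq D \<Longrightarrow> deriv_seq (\<lambda>k t. c * D k t)"
  by (auto simp: deriv_seq_def intro!: DERIV_cmult)

lemma deriv_seq_bdiff:
  assumes "deriv_seq D"
  shows "deriv_seq (\<lambda>k. bdiff (D k))"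
  using deriv_seq_diff[OF assms deriv_seq_affine[OF assms, of 1 "-1"]]
  by (simp add: bdiff_def[abs_def])

lemma abs_diff_le_of_deriv:
  fixes f :: "real \<Rightarrow> real"
  assumes "\<And>t. (f has_real_derivative f' t) (at t)" and "\<And>t. \<bar>f' t\<bar> \<le> B"
  shows "\<bar>f x - f y\<bar> \<le> B * \<bar>x - y\<bar>"
  using field_differentiable_bound[of UNIV f f' B x y] assms by simp

text \<open>The mean value inequality trades one difference for one derivative. It is applied at the
  top order, and the induction continues with the differenced family.\<close>

lemma abs_bdiff_funpow_le:
  assumes "deriv_seq D" and "\<And>t. \<bar>D k t\<bar> \<le> B"
  shows "\<bar>(bdiff ^^ k) (D 0) t\<bar> \<le> B"
  using assms
proof (induction k arbitrary: D)
  case 0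
  then show ?case by simp
next
  case (Suc k)
  have "\<bar>bdiff (D k) t\<bar> \<le> B" for t
    using abs_diff_le_of_deriv[OF deriv_seqD[OF Suc.prems(1)] Suc.prems(2), of t "t - 1"]
    by (simp add: bdiff_def)
  from Suc.IH[OF deriv_seq_bdiff[OF Suc.prems(1)] this]
  show ?case by (simp add: funpow_swap1)
qed

text \<open>Multiplication by \<open>1 - z\<close> replaces the coefficients by their backward
  differences. Boundary terms vanish by the support hypotheses, and each factor lengthens the range
  by one.\<close>

lemma summation_by_parts_funpow:
  fixes z :: complex
  assumes "\<And>s. s < 0 \<Longrightarrow> \<phi> s = 0" and "\<And>s. s \<ge> real N \<Longrightarrow> \<phi> s = 0"
  shows "(1 - z) ^ k * (\<Sum>j<N. of_real (\<phi> (real j)) * z ^ j)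
           = (\<Sum>j<N + k. of_real ((bdiff ^^ k) \<phi> (real j)) * z ^ j)"
  using assms
proof (induction k arbitrary: \<phi> N)
  case 0
  then show ?case by simp
next
  case (Suc k)
  \<comment> \<open>Both sums run over \<open>Suc N\<close> indices: here the last term vanishes, in
    the shifted sum the first one, where the argument is \<open>-1\<close>.\<close>
  have a: "(\<Sum>j<Suc N. of_real (\<phi> (real j)) * z ^ j) = (\<Sum>j<N. of_real (\<phi> (real j)) * z ^ j)"
    using Suc.prems(2)[of "real N"] by simp
  have b: "(\<Sum>j<Suc N. of_real (\<phi> (real j - 1)) * z ^ j) = z * (\<Sum>j<N. of_real (\<phi> (real j)) * z ^ j)"
    using Suc.prems(1)[of "-1"]
    by (subst sum.lessThan_Suc_shift) (simp add: sum_distrib_left mult_ac)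
  have "(1 - z) * (\<Sum>j<N. of_real (\<phi> (real j)) * z ^ j)
          = (\<Sum>j<Suc N. of_real (bdiff \<phi> (real j)) * z ^ j)"
    unfolding bdiff_def of_real_diff left_diff_distrib sum_subtractf a b by simp
  moreover have "(1 - z) ^ k * (\<Sum>j<Suc N. of_real (bdiff \<phi> (real j)) * z ^ j)
     = (\<Sum>j<Suc N + k. of_real ((bdiff ^^ k) (bdiff \<phi>) (real j)) * z ^ j)"
    using Suc.prems by (intro Suc.IH) (auto simp: bdiff_def)
  ultimately show ?case
    by (simp add: funpow_swap1 mult.assoc power_Suc2 del: power_Suc sum.lessThan_Suc)
qed

lemma norm_exp_sum_le:
  fixes z :: complex
  assumes D: "deriv_seq D" and B: "\<And>t. \<bar>D k t\<bar> \<le> B"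
    and supp: "\<And>s. s < 0 \<Longrightarrow> D 0 s = 0" "\<And>s. s \<ge> real N \<Longrightarrow> D 0 s = 0" and z: "norm z = 1"
  shows "norm (1 - z) ^ k * norm (\<Sum>j<N. of_real (D 0 (real j)) * z ^ j) \<le> real (N + k) * B"
proof -
  have "norm (1 - z) ^ k * norm (\<Sum>j<N. of_real (D 0 (real j)) * z ^ j)
      = norm (\<Sum>j<N + k. of_real ((bdiff ^^ k) (D 0) (real j)) * z ^ j)"
    by (simp only: summation_by_parts_funpow[OF supp, symmetric] norm_mult norm_power)
  also have "\<dots> \<le> (\<Sum>j<N + k. B)"
    by (rule sum_norm_le) (simp add: norm_mult norm_power z abs_bdiff_funpow_le[OF D B])
  finally show ?thesis by simp
qed

text \<open>The terms at \<open>s\<close> and \<open>- s\<close> pair into a cosine since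
  \<open>g\<close> is even; the induction peels off both ends.\<close>

lemma symmetric_exp_sum:
  fixes g :: "real \<Rightarrow> real"
  assumes "\<And>s. g (- s) = g s"
  shows "(\<Sum>i<2 * N + 1. of_real (g (real i - real N)) * cis (t * (real i - real N)))
           = of_real (g 0 + 2 * (\<Sum>j=1..N. g (real j) * cos (t * real j)))"
proof (induction N)
  case 0
  then show ?case by simp
next
  case (Suc N)
  define c where "c s = of_real (g s) * cis (t * s)" for s
  have "(\<Sum>i<2 * Suc N + 1. c (real i - real (Suc N)))
      = c (- real (Suc N)) + (\<Sum>i<2 * N + 1. c (real i - real N)) + c (real (Suc N))"
    by (simp add: sum.lessThan_Suc_shift[of _ "Suc (Suc (2*N))"] del: sum.lessThan_Suc)
       (simp add: algebra_simps)
  also have "c (- s) + X + c s = X + of_real (2 * g s * cos (t * s))" for s X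
    using assms[of s] by (simp add: c_def complex_eq_iff)
  finally show ?case
    using Suc by (simp add: c_def algebra_simps)
qed

subsection \<open>Averages over an interval\<close>

text \<open>For \<open>d > 0\<close> this is convolution with the normalized indicator of an
  interval of length \<open>d\<close>, rescaled to a fixed domain of integration.\<close>

definition avg :: "real \<Rightarrow> (real \<Rightarrow> real) \<Rightarrow> real \<Rightarrow> real" where
  "avg d f x = integral {-1/2..1/2} (\<lambda>u. f (x + d * u))"

definition cdiff :: "real \<Rightarrow> (real \<Rightarrow> real) \<Rightarrow> real \<Rightarrow> real" where
  "cdiff d f x = (f (x + d / 2) - f (x - d / 2)) / d"

text \<open>The constant 2 is the slope of the trapezoid from which all averages start. Averaging
  preserves it, so continuity is available at every stage.\<close>

definition lip2 :: "(real \<Rightarrow> real) \<Rightarrow> bool" where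
  "lip2 f \<longleftrightarrow> (\<forall>x y. \<bar>f x - f y\<bar> \<le> 2 * \<bar>x - y\<bar>)"

lemma lip2D: "lip2 f \<Longrightarrow> \<bar>f x - f y\<bar> \<le> 2 * \<bar>x - y\<bar>"
  by (simp add: lip2_def)

lemma lip2_continuous_on:
  assumes "lip2 f"
  shows "continuous_on S f"
proof -
  have "2-lipschitz_on S f"
    using assms by (auto simp: lip2_def dist_real_def intro!: lipschitz_onI)
  then show ?thesis by (rule lipschitz_on_continuous_on)
qed

lemma lip2_integrable:
  "lip2 f \<Longrightarrow> (\<lambda>u. f (x + d * u)) integrable_on {-1/2..1/2}"
  by (intro integrable_continuous_real continuous_on_compose2[OF lip2_continuous_on[of f UNIV]])
     (auto intro!: continuous_intros)

text \<open>Allowing different functions, points and widths covers Lipschitz bounds, convergence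
  and, by comparison with a constant function, sup bounds and plateau values.\<close>

lemma abs_avg_diff_le:
  assumes "lip2 f" "lip2 g"
    and "\<And>u. u \<in> {-1/2..1/2} \<Longrightarrow> \<bar>f (x + d * u) - g (y + e * u)\<bar> \<le> B"
  shows "\<bar>avg d f x - avg e g y\<bar> \<le> B"
proof -
  have "((\<lambda>u. f (x + d * u) - g (y + e * u)) has_integral (avg d f x - avg e g y)) {-1/2..1/2}"
    unfolding avg_def using assms(1,2)
    by (intro has_integral_diff integrable_integral lip2_integrable)
  moreover have "0 \<le> B"
    using assms(3)[of 0] by force
  ultimately have "norm (avg d f x - avg e g y) \<le> B * measure lborel {-1/2..1/2::real}"
    using assms(3) by (intro has_integral_bound_real) auto
  then show ?thesis by simp
qed

lemma avg_const: "avg d (\<lambda>_. c) x = c"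
  by (simp add: avg_def)

lemma lip2_const: "lip2 (\<lambda>_. c)"
  by (simp add: lip2_def)

lemma avg_eq_const:
  assumes "lip2 f" and "\<And>u. u \<in> {-1/2..1/2} \<Longrightarrow> f (x + d * u) = c"
  shows "avg d f x = c"
  using abs_avg_diff_le[OF assms(1) lip2_const[of c], where x=x and d=d and B=0 and y=0 and e=0] assms(2)
  by (simp add: avg_const)

lemma lip2_avg:
  assumes "lip2 f"
  shows "lip2 (avg d f)"
  unfolding lip2_def
proof (intro allI)
  fix x y
  have "\<bar>f (x + d * u) - f (y + d * u)\<bar> \<le> 2 * \<bar>x - y\<bar>" for u
    using lip2D[OF assms, of "x + d * u" "y + d * u"] by simp
  then show "\<bar>avg d f x - avg d f y\<bar> \<le> 2 * \<bar>x - y\<bar>"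
    by (rule abs_avg_diff_le[OF assms assms])
qed

lemma abs_avg_le:
  assumes "lip2 f" and "\<And>x. \<bar>f x\<bar> \<le> B"
  shows "\<bar>avg d f x\<bar> \<le> B"
  using abs_avg_diff_le[OF assms(1) lip2_const[of 0], where x=x and d=d and B=B and y=0 and e=0] assms(2)
  by (simp add: avg_const)

lemma avg_minus_self_le:
  assumes "lip2 f" "d \<ge> 0"
  shows "\<bar>avg d f x - f x\<bar> \<le> d"
proof -
  have "\<bar>f (x + d * u) - f x\<bar> \<le> d" if "u \<in> {-1/2..1/2}" for u
  proof -
    have "\<bar>f (x + d * u) - f x\<bar> \<le> 2 * (d * \<bar>u\<bar>)"
      using lip2D[OF assms(1), of "x + d * u" x] assms(2) by (simp add: abs_mult)
    also have "d * \<bar>u\<bar> \<le> d * (1 / 2)"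
      using that assms(2) by (intro mult_left_mono) auto
    finally show ?thesis by simp
  qed
  then show ?thesis
    using abs_avg_diff_le[OF assms(1) lip2_const[of "f x"], where x=x and d=d and B=d and y=0 and e=0]
    by (simp add: avg_const)
qed

lemma avg_even:
  assumes "\<And>x. f (- x) = f x"
  shows "avg d f (- x) = avg d f x"
proof -
  have "f (- x + d * u) = f (x + d * - u)" for u
    using assms[of "x + d * - u"] by simp
  then have "avg d f (- x) = integral {-1/2..1/2} (\<lambda>u. f (x + d * - u))"
    by (simp add: avg_def)
  also have "\<dots> = avg d f x"
    using Henstock_Kurzweil_Integration.integral_reflect_real[of "1/2" "-1/2" "\<lambda>u. f (x + d * u)"]
    by (simp add: avg_def)
  finally show ?thesis .
qed

text \<open>Near \<open>x\<close> the average equals \<open>cdiff d g\<close> for an antiderivative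
  \<open>g\<close> of \<open>f\<close>, and differentiating that turns \<open>g\<close> into
  \<open>f\<close>.\<close>

lemma avg_has_derivative:
  assumes f: "lip2 f" and d: "d > 0"
  shows "(avg d f has_real_derivative cdiff d f x) (at x)"
proof -
  \<comment> \<open>The interior of \<open>I\<close> contains \<open>y + d * u\<close> for every
    \<open>y\<close> at distance less than 1 from \<open>x\<close>.\<close>
  define I where "I = {x - d - 1 .. x + d + 1}"
  obtain g where "\<And>y. y \<in> I \<Longrightarrow> (g has_vector_derivative f y) (at y within I)"
    unfolding I_def using antiderivative_continuous[OF lip2_continuous_on[OF f], of "x - d - 1" "x + d + 1"]
    by metis
  then have g': "(g has_real_derivative f y) (at y within I)" if "y \<in> I" for y
    using that by (simp add: has_real_derivative_iff_has_vector_derivative)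
  have g: "(g has_real_derivative f y) (at y)" if "y \<in> interior I" for y
    using g'[of y] that interior_subset[of I] unfolding at_within_interior[OF that] by blast
  have int: "interior I = {x - d - 1 <..< x + d + 1}"
    by (simp add: I_def)
  have eq: "cdiff d g y = avg d f y" if "y \<in> ball x 1" for y
  proof -
    have y: "\<bar>y - x\<bar> < 1" using that by (simp add: dist_real_def)
    have "((\<lambda>u. f (y + d * u)) has_integral g (y + d * (1/2)) / d - g (y + d * (-1/2)) / d) {-1/2..1/2}"
    proof (rule fundamental_theorem_of_calculus)
      fix u :: real assume u: "u \<in> {-1/2..1/2}"
      have "\<bar>d * u\<bar> \<le> d * 1"
        unfolding abs_mult using u d by (intro mult_mono) auto
      then have "y + d * u \<in> interior I"
        using y unfolding int by (auto simp: abs_le_iff abs_less_iff)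
      from g[OF this] have "((\<lambda>u. g (y + d * u)) has_real_derivative f (y + d * u) * d) (at u)"
        by (rule DERIV_chain'[where f = "\<lambda>u. y + d * u" and g = g, rotated])
           (auto intro!: derivative_eq_intros)
      then have "((\<lambda>u. g (y + d * u) / d) has_real_derivative f (y + d * u) * d / d) (at u)"
        by (rule DERIV_cdivide)
      then show "((\<lambda>u. g (y + d * u) / d) has_vector_derivative f (y + d * u)) (at u within {-1/2..1/2})"
        using d by (simp add: has_real_derivative_iff_has_vector_derivative has_vector_derivative_at_within)
    qed simp
    from integral_unique[OF this] show ?thesis
      by (simp add: avg_def cdiff_def diff_divide_distrib)
  qed
  have A: "((\<lambda>y. g (y + e)) has_real_derivative f (x + e) * 1) (at x)" if "\<bar>e\<bar> \<le> d" for e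
  proof (rule DERIV_chain'[where f = "\<lambda>y. y + e" and g = g])
    show "((\<lambda>y. y + e) has_real_derivative 1) (at x)"
      by (auto intro!: derivative_eq_intros)
    show "(g has_real_derivative f (x + e)) (at (x + e))"
      using that by (intro g) (auto simp: int)
  qed
  have "(cdiff d g has_real_derivative cdiff d f x) (at x)"
    using DERIV_cdivide[OF DERIV_diff[OF A[of "d / 2"] A[of "- d / 2"]], of d] d
    by (simp add: cdiff_def[abs_def])
  then show ?thesis
    by (rule has_field_derivative_transform_within_open[OF _ open_ball[of x 1]])
       (simp_all add: eq)
qed

lemma cdiff_has_derivative:
  assumes "\<And>x. (f has_real_derivative f' x) (at x)"
  shows "(cdiff d f has_real_derivative cdiff d f' x) (at x)"
proof -
  have A: "((\<lambda>y. f (y + e)) has_real_derivative f' (x + e) * 1) (at x)" for e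
    by (rule DERIV_chain'[OF _ assms]) (auto intro!: derivative_eq_intros)
  show ?thesis
    using DERIV_cdivide[OF DERIV_diff[OF A[of "d / 2"] A[of "- d / 2"]], of d]
    by (simp add: cdiff_def[abs_def])
qed

lemma abs_cdiff_le:
  assumes "\<And>x. \<bar>f x\<bar> \<le> B" "d > 0"
  shows "\<bar>cdiff d f x\<bar> \<le> 2 / d * B"
proof -
  have "\<bar>f (x + d / 2) - f (x - d / 2)\<bar> \<le> 2 * B"
    using assms(1)[of "x + d / 2"] assms(1)[of "x - d / 2"] by linarith
  then show ?thesis
    using assms(2) by (simp add: cdiff_def divide_right_mono)
qed

subsection \<open>Infinitely many averages\<close>

text \<open>It is 1 up to 5/4 and 0 from 7/4 on. The margins of 1/4 to the targets 1 and 2 are half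
  of the total width 1/2 allowed for the boxes.\<close>

definition trapezoid :: "real \<Rightarrow> real" where
  "trapezoid x = max 0 (min 1 (7 / 2 - 2 * \<bar>x\<bar>))"

lemma lip2_trapezoid: "lip2 trapezoid"
  unfolding lip2_def trapezoid_def by (auto simp: max_def min_def abs_if)

locale box_widths =
  fixes \<delta> :: "nat \<Rightarrow> real"
  assumes width_pos: "\<And>j. \<delta> j > 0" and width_sum_le: "\<And>m. (\<Sum>j<m. \<delta> j) \<le> 1 / 2"
begin

text \<open>
  The width with the smallest index is applied last, so that the limit satisfies
  \<open>inf_avg k = avg (\<delta> k) (inf_avg (Suc k))\<close> and can be differentiated once per index.
\<close>

primrec fin_avg :: "nat \<Rightarrow> nat \<Rightarrow> real \<Rightarrow> real" where
  "fin_avg 0 k = trapezoid"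
| "fin_avg (Suc p) k = avg (\<delta> k) (fin_avg p (Suc k))"

definition inf_avg :: "nat \<Rightarrow> real \<Rightarrow> real" where
  "inf_avg k x = lim (\<lambda>p. fin_avg p k x)"

lemma lip2_fin_avg: "lip2 (fin_avg p k)"
  by (induction p arbitrary: k) (simp_all add: lip2_trapezoid lip2_avg)

lemma abs_fin_avg_le: "\<bar>fin_avg p k x\<bar> \<le> 1"
proof (induction p arbitrary: k x)
  case 0
  then show ?case by (simp add: trapezoid_def)
next
  case (Suc p)
  then show ?case by (simp add: abs_avg_le lip2_fin_avg)
qed

lemma fin_avg_even: "fin_avg p k (- x) = fin_avg p k x"
proof (induction p arbitrary: k x)
  case 0
  then show ?case by (simp add: trapezoid_def)
next
  case (Suc p)
  then show ?case by (simp add: avg_even)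
qed

text \<open>The two sides differ by one innermost average of the trapezoid, and the outer averages
  do not increase sup distances.\<close>

lemma fin_avg_step: "\<bar>fin_avg (Suc p) k x - fin_avg p k x\<bar> \<le> \<delta> (k + p)"
proof (induction p arbitrary: k x)
  case 0
  then show ?case using avg_minus_self_le[OF lip2_trapezoid] width_pos[of k] by simp
next
  case (Suc p)
  have "\<bar>avg (\<delta> k) (fin_avg (Suc p) (Suc k)) x - avg (\<delta> k) (fin_avg p (Suc k)) x\<bar> \<le> \<delta> (Suc k + p)"
    by (rule abs_avg_diff_le[OF lip2_fin_avg lip2_fin_avg Suc.IH])
  then show ?case by simp
qed

lemma abs_width_mult_le:
  assumes "u \<in> {-1/2..1/2::real}"
  shows "\<bar>\<delta> k * u\<bar> \<le> \<delta> k / 2"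
proof -
  have "\<delta> k * \<bar>u\<bar> \<le> \<delta> k * (1 / 2)"
    using assms width_pos[of k] by (intro mult_left_mono) auto
  then show ?thesis using width_pos[of k] by (simp add: abs_mult)
qed

text \<open>Each average moves the argument by at most half its width, so all points reached stay on
  the plateau of the trapezoid.\<close>

lemma fin_avg_inner: "\<bar>x\<bar> + (\<Sum>j=k..<k + p. \<delta> j) / 2 \<le> 5 / 4 \<Longrightarrow> fin_avg p k x = 1"
proof (induction p arbitrary: k x)
  case 0
  then show ?case by (simp add: trapezoid_def)
next
  case (Suc p)
  have s: "(\<Sum>j=k..<k + Suc p. \<delta> j) = \<delta> k + (\<Sum>j=Suc k..<Suc k + p. \<delta> j)"
    by (simp add: sum.atLeast_Suc_lessThan)
  have "fin_avg p (Suc k) (x + \<delta> k * u) = 1" if "u \<in> {-1/2..1/2}" for u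
    using abs_width_mult_le[OF that, of k] Suc.prems s
    by (intro Suc.IH) linarith
  then show ?case unfolding fin_avg.simps by (rule avg_eq_const[OF lip2_fin_avg])
qed

lemma fin_avg_outer: "\<bar>x\<bar> - (\<Sum>j=k..<k + p. \<delta> j) / 2 \<ge> 7 / 4 \<Longrightarrow> fin_avg p k x = 0"
proof (induction p arbitrary: k x)
  case 0
  then show ?case by (simp add: trapezoid_def)
next
  case (Suc p)
  have s: "(\<Sum>j=k..<k + Suc p. \<delta> j) = \<delta> k + (\<Sum>j=Suc k..<Suc k + p. \<delta> j)"
    by (simp add: sum.atLeast_Suc_lessThan)
  have "fin_avg p (Suc k) (x + \<delta> k * u) = 0" if "u \<in> {-1/2..1/2}" for u
    using abs_width_mult_le[OF that, of k] Suc.prems s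
    by (intro Suc.IH) linarith
  then show ?case unfolding fin_avg.simps by (rule avg_eq_const[OF lip2_fin_avg])
qed

lemma summable_width: "summable \<delta>"
  using width_pos width_sum_le
  by (intro summableI_nonneg_bounded[where x = "1/2"]) (auto intro: less_imp_le)

definition width_tail :: "nat \<Rightarrow> real" where
  "width_tail m = (\<Sum>j. \<delta> (j + m))"

lemma width_tail_tendsto_0: "width_tail \<longlonglongrightarrow> 0"
proof -
  have "(\<lambda>m. suminf \<delta> - (\<Sum>j<m. \<delta> j)) \<longlonglongrightarrow> suminf \<delta> - suminf \<delta>"
    by (intro tendsto_intros summable_LIMSEQ summable_width)
  then show ?thesis
    by (simp add: width_tail_def[abs_def] suminf_minus_initial_segment[OF summable_width])
qed

lemma fin_avg_diff_le: "\<bar>fin_avg (r + p) k x - fin_avg p k x\<bar> \<le> width_tail (k + p)"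
proof -
  have "\<bar>fin_avg (r + p) k x - fin_avg p k x\<bar> \<le> (\<Sum>i<r. \<delta> (i + (k + p)))"
  proof (induction r)
    case (Suc r)
    then show ?case
      using fin_avg_step[of "r + p" k x] by (simp add: add_ac del: fin_avg.simps)
  qed simp
  also have "\<dots> \<le> width_tail (k + p)"
    unfolding width_tail_def using width_pos summable_width
    by (intro sum_le_suminf summable_ignore_initial_segment) (auto intro: less_imp_le)
  finally show ?thesis .
qed

lemma fin_avg_tendsto: "(\<lambda>p. fin_avg p k x) \<longlonglongrightarrow> inf_avg k x"
proof -
  have "summable (\<lambda>p. fin_avg (Suc p) k x - fin_avg p k x)"
    using fin_avg_step
    by (intro summable_comparison_test'[OF summable_ignore_initial_segment[OF summable_width, of k]])
       (simp add: add.commute)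
  then have "convergent (\<lambda>p. \<Sum>i<p. fin_avg (Suc i) k x - fin_avg i k x)"
    by (simp add: summable_iff_convergent)
  then have "convergent (\<lambda>p. fin_avg p k x - fin_avg 0 k x)"
    by (simp only: sum_lessThan_telescope[of "\<lambda>p. fin_avg p k x"])
  then have "convergent (\<lambda>p. fin_avg p k x)"
    by (simp add: convergent_diff_const_right_iff)
  then show ?thesis
    by (simp add: inf_avg_def convergent_LIMSEQ_iff)
qed

lemma inf_avg_diff_le: "\<bar>inf_avg k x - fin_avg p k x\<bar> \<le> width_tail (k + p)"
proof -
  have "(\<lambda>r. \<bar>fin_avg (r + p) k x - fin_avg p k x\<bar>) \<longlonglongrightarrow> \<bar>inf_avg k x - fin_avg p k x\<bar>"
    by (intro tendsto_intros LIMSEQ_ignore_initial_segment fin_avg_tendsto)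
  then show ?thesis
    by (rule LIMSEQ_le_const2) (use fin_avg_diff_le in auto)
qed

lemma lip2_inf_avg: "lip2 (inf_avg k)"
  unfolding lip2_def
proof (intro allI)
  fix x y
  have "(\<lambda>p. \<bar>fin_avg p k x - fin_avg p k y\<bar>) \<longlonglongrightarrow> \<bar>inf_avg k x - inf_avg k y\<bar>"
    by (intro tendsto_intros fin_avg_tendsto)
  then show "\<bar>inf_avg k x - inf_avg k y\<bar> \<le> 2 * \<bar>x - y\<bar>"
    by (rule LIMSEQ_le_const2) (use lip2D[OF lip2_fin_avg] in auto)
qed

lemma abs_inf_avg_le: "\<bar>inf_avg k x\<bar> \<le> 1"
  by (rule LIMSEQ_le_const2[OF tendsto_rabs[OF fin_avg_tendsto]]) (use abs_fin_avg_le in auto)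

lemma inf_avg_even: "inf_avg k (- x) = inf_avg k x"
  by (simp add: inf_avg_def fin_avg_even)

lemma inf_avg_inner:
  assumes "\<bar>x\<bar> \<le> 1"
  shows "inf_avg 0 x = 1"
proof -
  have "fin_avg p 0 x = 1" for p
    using width_sum_le[of p] assms by (intro fin_avg_inner) (simp add: lessThan_atLeast0)
  then show ?thesis by (simp add: inf_avg_def)
qed

lemma inf_avg_outer:
  assumes "\<bar>x\<bar> \<ge> 2"
  shows "inf_avg 0 x = 0"
proof -
  have "fin_avg p 0 x = 0" for p
    using width_sum_le[of p] assms by (intro fin_avg_outer) (simp add: lessThan_atLeast0)
  then show ?thesis by (simp add: inf_avg_def)
qed

text \<open>The recursion for \<open>fin_avg\<close> passes to the limit under the integral because
  \<open>width_tail\<close> bounds the error uniformly in the argument.\<close>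

lemma inf_avg_eq_avg: "inf_avg k = avg (\<delta> k) (inf_avg (Suc k))"
proof
  fix x
  have "\<bar>fin_avg (Suc p) k x - avg (\<delta> k) (inf_avg (Suc k)) x\<bar> \<le> width_tail (p + Suc k)" for p
    unfolding fin_avg.simps
    using inf_avg_diff_le[of "Suc k" _ p]
    by (intro abs_avg_diff_le lip2_fin_avg lip2_inf_avg) (simp add: abs_minus_commute add.commute)
  then have "(\<lambda>p. fin_avg (Suc p) k x - avg (\<delta> k) (inf_avg (Suc k)) x) \<longlonglongrightarrow> 0"
    by (intro Lim_null_comparison[OF _ LIMSEQ_ignore_initial_segment[OF width_tail_tendsto_0, of "Suc k"]])
       (simp del: fin_avg.simps)
  then have "(\<lambda>p. fin_avg (Suc p) k x) \<longlonglongrightarrow> avg (\<delta> k) (inf_avg (Suc k)) x"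
    by (rule LIM_zero_cancel)
  moreover have "(\<lambda>p. fin_avg (Suc p) k x) \<longlonglongrightarrow> inf_avg k x"
    using fin_avg_tendsto by (rule LIMSEQ_Suc)
  ultimately show "inf_avg k x = avg (\<delta> k) (inf_avg (Suc k)) x"
    using LIMSEQ_unique by blast
qed

text \<open>Differentiating the innermost \<open>inf_avg k\<close> leaves
  \<open>cdiff (\<delta> k) (inf_avg (Suc k))\<close>, so the newest difference is placed
  innermost.\<close>

primrec cdiffs :: "nat \<Rightarrow> (real \<Rightarrow> real) \<Rightarrow> real \<Rightarrow> real" where
  "cdiffs 0 f = f"
| "cdiffs (Suc k) f = cdiffs k (cdiff (\<delta> k) f)"

lemma cdiffs_has_derivative:
  assumes "\<And>x. (f has_real_derivative f' x) (at x)"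
  shows "(cdiffs k f has_real_derivative cdiffs k f' x) (at x)"
  using assms by (induction k arbitrary: f f') (simp_all add: cdiff_has_derivative)

lemma abs_cdiffs_le:
  assumes "\<And>x. \<bar>f x\<bar> \<le> B"
  shows "\<bar>cdiffs k f x\<bar> \<le> (\<Prod>j<k. 2 / \<delta> j) * B"
  using assms
proof (induction k arbitrary: f B)
  case (Suc k)
  from Suc.IH[OF abs_cdiff_le[OF Suc.prems width_pos]] show ?case
    by (simp add: mult_ac)
qed simp

lemma deriv_seq_cdiffs: "deriv_seq (\<lambda>k. cdiffs k (inf_avg k))"
  unfolding deriv_seq_def
proof (intro allI)
  fix k t
  have "(inf_avg k has_real_derivative cdiff (\<delta> k) (inf_avg (Suc k)) x) (at x)" for x
    unfolding inf_avg_eq_avg[of k] by (rule avg_has_derivative[OF lip2_inf_avg width_pos])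
  then show "(cdiffs k (inf_avg k) has_real_derivative cdiffs (Suc k) (inf_avg (Suc k)) t) (at t)"
    by (simp add: cdiffs_has_derivative)
qed

lemma exists_bump:
  "\<exists>D. deriv_seq D \<and> (\<forall>k t. \<bar>D k t\<bar> \<le> (\<Prod>j<k. 2 / \<delta> j)) \<and> (\<forall>t. D 0 (- t) = D 0 t)
     \<and> (\<forall>t. \<bar>t\<bar> \<le> 1 \<longrightarrow> D 0 t = 1) \<and> (\<forall>t. \<bar>t\<bar> \<ge> 2 \<longrightarrow> D 0 t = 0)"
  using deriv_seq_cdiffs abs_cdiffs_le[OF abs_inf_avg_le] inf_avg_even inf_avg_inner inf_avg_outer
  by (intro exI[of _ "\<lambda>k. cdiffs k (inf_avg k)"]) simp

end

subsection \<open>Derivatives of the cosine of a function\<close>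

text \<open>
  The phase \<open>b\<close> counts quarter periods: differentiating the cosine raises \<open>b\<close> by one, so a single
  family describes the derivatives of the sine and of the cosine of \<open>G 0\<close>.
\<close>

fun cos_derivs :: "(nat \<Rightarrow> real \<Rightarrow> real) \<Rightarrow> nat \<Rightarrow> nat \<Rightarrow> real \<Rightarrow> real" where
  "cos_derivs G b 0 t = cos (G 0 t + real b * (pi / 2))"
| "cos_derivs G b (Suc k) t =
     (\<Sum>i\<le>k. real (k choose i) * cos_derivs G (Suc b) i t * G (Suc k - i) t)"

text \<open>By Pascal's rule, differentiating one Leibniz sum termwise gives the next.\<close>

lemma leibniz_step:
  fixes u g :: "nat \<Rightarrow> real"
  shows "(\<Sum>i\<le>m. real (m choose i) * (u (Suc i) * g (Suc m - i) + u i * g (Suc (Suc m) - i)))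
       = (\<Sum>i\<le>Suc m. real (Suc m choose i) * u i * g (Suc (Suc m) - i))"
proof -
  \<comment> \<open>The added term at \<open>Suc m\<close> is zero because
    \<open>m choose Suc m\<close> is.\<close>
  have "(\<Sum>i\<le>m. real (m choose i) * u i * g (Suc (Suc m) - i))
      = (\<Sum>i\<le>Suc m. real (m choose i) * u i * g (Suc (Suc m) - i))"
    by simp
  also have "\<dots> = u 0 * g (Suc (Suc m)) + (\<Sum>i\<le>m. real (m choose Suc i) * u (Suc i) * g (Suc m - i))"
    by (subst sum.atMost_Suc_shift) simp
  finally have "(\<Sum>i\<le>m. real (m choose i) * u (Suc i) * g (Suc m - i))
      + (\<Sum>i\<le>m. real (m choose i) * u i * g (Suc (Suc m) - i))
      = u 0 * g (Suc (Suc m)) + (\<Sum>i\<le>m. real (Suc m choose Suc i) * u (Suc i) * g (Suc m - i))"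
    by (simp add: sum.distrib algebra_simps)
  then show ?thesis
    by (subst sum.atMost_Suc_shift) (simp add: sum.distrib algebra_simps)
qed

text \<open>Induction is strong, and over all phases, because order \<open>Suc m\<close> involves
  every order up to \<open>m\<close> at phase \<open>Suc b\<close>.\<close>

lemma cos_derivs_has_derivative:
  assumes G: "deriv_seq G"
  shows "(cos_derivs G b k has_real_derivative cos_derivs G b (Suc k) t) (at t)"
proof (induction k arbitrary: b rule: less_induct)
  case (less k)
  show ?case
  proof (cases k)
    case 0
    have "((\<lambda>t. cos (G 0 t + real b * (pi / 2))) has_real_derivative
            - sin (G 0 t + real b * (pi / 2)) * G 1 t) (at t)"
      using deriv_seqD[OF G, of 0 t] by (auto intro!: derivative_eq_intros)
    also have "- sin (G 0 t + real b * (pi / 2)) = cos (G 0 t + real b * (pi / 2) + pi / 2)"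
      by (simp add: cos_add)
    also have "G 0 t + real b * (pi / 2) + pi / 2 = G 0 t + real (Suc b) * (pi / 2)"
      by (simp add: field_simps)
    finally show ?thesis
      by (simp only: 0 cos_derivs.simps) simp
  next
    case (Suc m)
    have "(cos_derivs G b (Suc m) has_real_derivative
        (\<Sum>i\<le>m. real (m choose i) * (cos_derivs G (Suc b) (Suc i) t * G (Suc m - i) t
                   + cos_derivs G (Suc b) i t * G (Suc (Suc m) - i) t))) (at t)"
      unfolding cos_derivs.simps(2)[abs_def, of G b m]
    proof (rule DERIV_sum)
      fix i assume i: "i \<in> {..m}"
      have 1: "(cos_derivs G (Suc b) i has_real_derivative cos_derivs G (Suc b) (Suc i) t) (at t)"
        using i Suc by (intro less.IH) auto
      have 2: "(G (Suc m - i) has_real_derivative G (Suc (Suc m) - i) t) (at t)"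
        using deriv_seqD[OF G, of "Suc m - i" t] i by (simp add: Suc_diff_le)
      show "((\<lambda>t. real (m choose i) * cos_derivs G (Suc b) i t * G (Suc m - i) t) has_real_derivative
         real (m choose i) * (cos_derivs G (Suc b) (Suc i) t * G (Suc m - i) t
                   + cos_derivs G (Suc b) i t * G (Suc (Suc m) - i) t)) (at t)"
        using DERIV_cmult[OF DERIV_mult[OF 1 2], of "real (m choose i)"]
        by (simp add: algebra_simps del: cos_derivs.simps)
    qed
    then show ?thesis
      unfolding Suc leibniz_step[of m "\<lambda>i. cos_derivs G (Suc b) i t" "\<lambda>j. G j t"]
        cos_derivs.simps(2)[of G b "Suc m"] .
  qed
qed

text \<open>\<open>M_mult\<close> absorbs the binomial coefficients, leaving the geometric sum of
  \<open>C * (C + 1) ^ i\<close>, which is \<open>(C + 1) ^ Suc m - 1\<close>. This is why the base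
  is \<open>C + 1\<close>.\<close>

lemma abs_cos_derivs_le:
  assumes M0: "M 0 = 1" and M_nonneg: "\<And>k. 0 \<le> M k"
    and M_mult: "\<And>k i. i \<le> k \<Longrightarrow> real (k choose i) * M i * M (Suc k - i) \<le> M (Suc k)"
    and G: "\<And>k. \<bar>G k t\<bar> \<le> C * M k" and C: "0 < C"
  shows "\<bar>cos_derivs G b k t\<bar> \<le> (C + 1) ^ k * M k"
proof (induction k arbitrary: b rule: less_induct)
  case (less k)
  show ?case
  proof (cases k)
    case 0
    then show ?thesis by (simp add: M0)
  next
    case (Suc m)
    have "\<bar>cos_derivs G b (Suc m) t\<bar>
        \<le> (\<Sum>i\<le>m. \<bar>real (m choose i) * cos_derivs G (Suc b) i t * G (Suc m - i) t\<bar>)"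
      by (simp del: power_Suc)
    also have "\<dots> \<le> (\<Sum>i\<le>m. C * (C + 1) ^ i * M (Suc m))"
    proof (rule sum_mono)
      fix i assume i: "i \<in> {..m}"
      have "\<bar>real (m choose i) * cos_derivs G (Suc b) i t * G (Suc m - i) t\<bar>
          \<le> real (m choose i) * ((C + 1) ^ i * M i) * (C * M (Suc m - i))"
        unfolding abs_mult using i Suc M_nonneg C
        by (intro mult_mono less.IH G) (auto intro!: mult_nonneg_nonneg)
      also have "\<dots> = C * (C + 1) ^ i * (real (m choose i) * M i * M (Suc m - i))"
        by (simp only: mult_ac)
      also have "\<dots> \<le> C * (C + 1) ^ i * M (Suc m)"
        using i C by (intro mult_left_mono M_mult) auto
      finally show "\<bar>real (m choose i) * cos_derivs G (Suc b) i t * G (Suc m - i) t\<bar>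
          \<le> C * (C + 1) ^ i * M (Suc m)" .
    qed
    also have "\<dots> = (C * (\<Sum>i\<le>m. (C + 1) ^ i)) * M (Suc m)"
      by (simp add: sum_distrib_left sum_distrib_right)
    also have "C * (\<Sum>i\<le>m. (C + 1) ^ i) = (C + 1) ^ Suc m - 1"
      using power_diff_1_eq[of "C + 1" "Suc m"] by (simp add: lessThan_Suc_atMost)
    also have "((C + 1) ^ Suc m - 1) * M (Suc m) \<le> (C + 1) ^ Suc m * M (Suc m)"
      using M_nonneg[of "Suc m"] by (intro mult_right_mono) auto
    finally show ?thesis unfolding Suc .
  qed
qed

subsection \<open>Logarithmic weights\<close>

definition logw :: "real \<Rightarrow> nat \<Rightarrow> real" where
  "logw \<epsilon> j = ln (exp 1 + real (Suc j)) powr (1 + \<epsilon>)"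

definition weight :: "real \<Rightarrow> real \<Rightarrow> nat \<Rightarrow> real" where
  "weight \<Lambda> \<epsilon> k = (\<Prod>j<k. \<Lambda> * real (Suc j) * logw \<epsilon> j)"

lemma ln_exp1_add_ge_1: "0 \<le> x \<Longrightarrow> 1 \<le> ln (exp 1 + x :: real)"
  using ln_le_cancel_iff[of "exp 1" "exp 1 + x"] by (simp add: add_pos_nonneg)

lemma logw_pos: "0 < logw \<epsilon> j"
  using ln_exp1_add_ge_1[of "real (Suc j)"] by (simp add: logw_def)

lemma logw_mono: "0 \<le> \<epsilon> \<Longrightarrow> i \<le> j \<Longrightarrow> logw \<epsilon> i \<le> logw \<epsilon> j"
  unfolding logw_def using ln_exp1_add_ge_1[of "real (Suc i)"]
  by (intro powr_mono2) (auto simp: add_pos_pos)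

lemma weight_nonneg: "0 \<le> \<Lambda> \<Longrightarrow> 0 \<le> weight \<Lambda> \<epsilon> k"
  unfolding weight_def by (intro prod_nonneg) (simp add: less_imp_le[OF logw_pos])

lemma weight_scale: "c ^ k * weight \<Lambda> \<epsilon> k = weight (c * \<Lambda>) \<epsilon> k"
  by (induction k) (auto simp: weight_def)

lemma weight_mono: "0 \<le> \<Lambda> \<Longrightarrow> \<Lambda> \<le> \<Lambda>' \<Longrightarrow> weight \<Lambda> \<epsilon> k \<le> weight \<Lambda>' \<epsilon> k"
  unfolding weight_def using logw_pos
  by (intro prod_mono conjI mult_right_mono mult_nonneg_nonneg) (auto intro: less_imp_le)

lemma weight_eq: "weight \<Lambda> \<epsilon> k = \<Lambda> ^ k * fact k * (\<Prod>j<k. logw \<epsilon> j)"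
  by (induction k) (auto simp: weight_def algebra_simps)

text \<open>The second block of factors is dominated by the later factors of the long product, as
  \<open>logw\<close> increases.\<close>

lemma prod_logw_mult_le:
  assumes "0 \<le> \<epsilon>"
  shows "(\<Prod>j<i. logw \<epsilon> j) * (\<Prod>j<l. logw \<epsilon> j) \<le> (\<Prod>j<i + l. logw \<epsilon> j)"
proof (induction l)
  case (Suc l)
  have "((\<Prod>j<i. logw \<epsilon> j) * (\<Prod>j<l. logw \<epsilon> j)) * logw \<epsilon> l \<le> (\<Prod>j<i + l. logw \<epsilon> j) * logw \<epsilon> (i + l)"
    using Suc assms logw_pos
    by (intro mult_mono logw_mono prod_nonneg) (auto intro: less_imp_le)
  then show ?case by (simp add: mult_ac)
qed simp

text \<open>This is \<open>M_mult\<close> for the weights: the binomial coefficient and the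
  factorials give \<open>k! (k + 1 - i)\<close>, at most \<open>(k + 1)!\<close>.\<close>

lemma weight_mult_le:
  assumes "0 \<le> \<epsilon>" "0 \<le> \<Lambda>" "i \<le> k"
  shows "real (k choose i) * weight \<Lambda> \<epsilon> i * weight \<Lambda> \<epsilon> (Suc k - i) \<le> weight \<Lambda> \<epsilon> (Suc k)"
proof -
  let ?P = "\<lambda>k. \<Prod>j<k. logw \<epsilon> j"
  have "real (k choose i) * weight \<Lambda> \<epsilon> i * weight \<Lambda> \<epsilon> (Suc k - i)
      = (real (k choose i) * fact i * fact (Suc k - i)) * (\<Lambda> ^ i * \<Lambda> ^ (Suc k - i))
         * (?P i * ?P (Suc k - i))"
    by (simp add: weight_eq mult_ac)
  also have "\<Lambda> ^ i * \<Lambda> ^ (Suc k - i) = \<Lambda> ^ Suc k"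
    using assms(3) by (simp flip: power_add)
  also have "real (k choose i) * fact i * fact (Suc k - i) = real (fact i * fact (k - i) * (k choose i)) * real (Suc (k - i))"
    using assms(3) by (simp add: Suc_diff_le mult_ac)
  also have "fact i * fact (k - i) * (k choose i) = fact k"
    using binomial_fact_lemma[OF assms(3)] .
  also have "(real (fact k) * real (Suc (k - i))) * \<Lambda> ^ Suc k * (?P i * ?P (Suc k - i))
      \<le> (real (fact k) * real (Suc k)) * \<Lambda> ^ Suc k * ?P (Suc k)"
    using assms prod_logw_mult_le[OF assms(1), of i "Suc k - i"] logw_pos
    by (intro mult_mono) (auto intro!: mult_nonneg_nonneg prod_nonneg intro: less_imp_le)
  also have "\<dots> = weight \<Lambda> \<epsilon> (Suc k)"
    by (simp add: weight_eq algebra_simps)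
  finally show ?thesis .
qed

lemma weight_le_power:
  assumes "0 \<le> \<epsilon>" "0 \<le> \<Lambda>" "real k \<le> q"
  shows "weight \<Lambda> \<epsilon> k \<le> (\<Lambda> * real k * ln (exp 1 + q) powr (1 + \<epsilon>)) ^ k"
proof -
  have "weight \<Lambda> \<epsilon> k \<le> (\<Prod>j<k. \<Lambda> * real k * ln (exp 1 + q) powr (1 + \<epsilon>))"
    unfolding weight_def
  proof (intro prod_mono conjI)
    fix j assume j: "j \<in> {..<k}"
    show "0 \<le> \<Lambda> * real (Suc j) * logw \<epsilon> j"
      using assms logw_pos[of \<epsilon> j] by (simp add: less_imp_le)
    have "logw \<epsilon> j \<le> ln (exp 1 + q) powr (1 + \<epsilon>)"
      unfolding logw_def using ln_exp1_add_ge_1[of "real (Suc j)"] assms j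
      by (intro powr_mono2) (auto simp: add_pos_pos)
    then show "\<Lambda> * real (Suc j) * logw \<epsilon> j \<le> \<Lambda> * real k * ln (exp 1 + q) powr (1 + \<epsilon>)"
      using assms j logw_pos[of \<epsilon> j] by (intro mult_mono) (auto simp: less_imp_le)
  qed
  then show ?thesis by simp
qed

text \<open>The derivative of \<open>ln x powr (- \<epsilon>)\<close> has size
  \<open>\<epsilon> / (x * ln x powr (1 + \<epsilon>))\<close>, so the mean value theorem gives a
  telescoping bound whose total does not grow as \<epsilon> tends to 0.\<close>

lemma width_term_le:
  assumes "0 < \<epsilon>"
  shows "\<epsilon> / (real (Suc j) * logw \<epsilon> j)
    \<le> 4 * (ln (exp 1 + real j) powr (- \<epsilon>) - ln (exp 1 + real (Suc j)) powr (- \<epsilon>))"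
proof -
  define a where "a = exp 1 + real j"
  have "a \<ge> exp 1" by (simp add: a_def)
  moreover have "exp 1 > (1::real)" by simp
  ultimately have a: "a \<ge> exp 1" "a > 0" "a > 1" by linarith+
  have ln1: "1 \<le> ln x" if "x \<ge> a" for x
    using ln_exp1_add_ge_1[of "x - exp 1"] that a by simp
  have "((\<lambda>x. ln x powr (- \<epsilon>)) has_real_derivative - (\<epsilon> * ln x powr (- 1 - \<epsilon>) / x)) (at x)"
    if "a \<le> x" for x
    using ln1[OF that] that a by (auto intro!: derivative_eq_intros simp: minus_diff_commute)
  from MVT2[of a "a + 1", OF _ this] obtain z where z: "a < z" "z < a + 1"
    and eq: "ln (a + 1) powr (- \<epsilon>) - ln a powr (- \<epsilon>) = - (\<epsilon> * ln z powr (- 1 - \<epsilon>) / z)"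
    by auto
  \<comment> \<open>The factor 4 originates here: \<open>e + j + 1\<close> is at most
    \<open>j + 4\<close>.\<close>
  have "exp 1 \<le> (3::real)" by (rule exp_le)
  then have "a + 1 \<le> 4 * real (Suc j)" by (simp add: a_def)
  then have "\<epsilon> / (real (Suc j) * logw \<epsilon> j) \<le> \<epsilon> / ((a + 1) / 4 * logw \<epsilon> j)"
    using a logw_pos[of \<epsilon> j] assms
    by (intro divide_left_mono mult_right_mono mult_pos_pos) auto
  also have "\<dots> = 4 * (\<epsilon> / ((a + 1) * logw \<epsilon> j))"
    by simp
  also have "(a + 1) * logw \<epsilon> j = (a + 1) * ln (a + 1) powr (1 + \<epsilon>)"
    by (simp add: logw_def a_def add_ac)
  also have "\<epsilon> / ((a + 1) * ln (a + 1) powr (1 + \<epsilon>)) \<le> \<epsilon> / (z * ln z powr (1 + \<epsilon>))"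
    using z a assms ln1[of z] ln1[of "a + 1"]
    by (intro divide_left_mono mult_mono powr_mono2 mult_pos_pos) auto
  also have "\<dots> = \<epsilon> * ln z powr (- 1 - \<epsilon>) / z"
    using powr_minus[of "ln z" "1 + \<epsilon>"] z a by (simp add: field_simps)
  also have "\<dots> = ln a powr (- \<epsilon>) - ln (a + 1) powr (- \<epsilon>)"
    using eq by simp
  finally show ?thesis by (simp add: a_def add_ac)
qed

text \<open>The telescoping sum starts at \<open>ln e powr (- \<epsilon>)\<close>, which is 1;
  dividing 4 by 8 leaves the bound 1/2.\<close>

lemma box_widths_log:
  assumes "0 < \<epsilon>"
  shows "box_widths (\<lambda>j. \<epsilon> / (8 * (real (Suc j) * logw \<epsilon> j)))"
proof
  show "0 < \<epsilon> / (8 * (real (Suc j) * logw \<epsilon> j))" for j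
    using assms logw_pos[of \<epsilon> j] by simp
next
  fix m
  let ?v = "\<lambda>j. ln (exp 1 + real j) powr (- \<epsilon>)"
  have half: "a / 8 \<le> b / 2" if "a \<le> 4 * b" for a b :: real
    using that by simp
  have "(\<Sum>j<m. \<epsilon> / (8 * (real (Suc j) * logw \<epsilon> j))) \<le> (\<Sum>j<m. (?v j - ?v (Suc j)) / 2)"
  proof (rule sum_mono)
    fix j
    show "\<epsilon> / (8 * (real (Suc j) * logw \<epsilon> j)) \<le> (?v j - ?v (Suc j)) / 2"
      using half[OF width_term_le[OF assms, of j]] by (simp only: divide_divide_eq_left')
  qed
  also have "\<dots> = (?v 0 - ?v m) / 2"
    by (simp only: sum_lessThan_telescope'[of ?v] flip: sum_divide_distrib)
  also have "\<dots> \<le> 1 / 2" by simp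
  finally show "(\<Sum>j<m. \<epsilon> / (8 * (real (Suc j) * logw \<epsilon> j))) \<le> 1 / 2" .
qed

subsection \<open>Localization of the kernel\<close>

text \<open>With \<open>y = x / 2\<close>, the double angle formula reduces the claim to
  \<open>y * cos y \<le> sin y\<close> and to \<open>1 / 2 \<le> (cos y)\<^sup>2\<close>, the latter
  because \<open>cos (2 * y)\<close> is nonnegative.\<close>

lemma sin_ge_half:
  assumes "0 \<le> x" "x \<le> pi / 2"
  shows "x / 2 \<le> sin x"
proof -
  define y where "y = x / 2"
  have y: "0 \<le> y" "2 * y \<le> pi / 2" "x = 2 * y" using assms by (auto simp: y_def)
  have "(\<lambda>y. sin y - y * cos y) 0 \<le> (\<lambda>y. sin y - y * cos y) y"
  proof (rule DERIV_nonneg_imp_nondecreasing[OF y(1)])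
    fix u assume u: "0 \<le> u" "u \<le> y"
    have "((\<lambda>y. sin y - y * cos y) has_real_derivative u * sin u) (at u)"
      by (auto intro!: derivative_eq_intros)
    moreover have "0 \<le> u * sin u"
      using u y pi_gt_zero by (intro mult_nonneg_nonneg sin_ge_zero) linarith+
    ultimately show "\<exists>D. ((\<lambda>y. sin y - y * cos y) has_real_derivative D) (at u) \<and> 0 \<le> D"
      by blast
  qed
  then have 1: "y * cos y \<le> sin y" by simp
  have cos: "0 \<le> cos y" "0 \<le> cos x"
    using y assms pi_gt_zero by (intro cos_ge_zero; linarith)+
  have "x / 2 \<le> 2 * y * (cos y)\<^sup>2"
  proof -
    have "1 / 2 \<le> (cos y)\<^sup>2"
      using cos(2) unfolding y(3) cos_double_cos by simp
    then have "y * (1 / 2) \<le> y * (cos y)\<^sup>2"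
      using y(1) by (rule mult_left_mono)
    then show ?thesis using y(3) by simp
  qed
  also have "\<dots> = 2 * (y * cos y) * cos y" by (simp add: power2_eq_square)
  also have "\<dots> \<le> 2 * sin y * cos y"
    using 1 cos by (intro mult_right_mono mult_left_mono) auto
  also have "\<dots> = sin x" by (simp add: y(3) sin_double)
  finally show ?thesis .
qed

text \<open>The norm is twice the absolute value of \<open>sin (t / 2)\<close>, and \<open>r\<close>
  bounds from below the distance of \<open>t\<close> to the multiples of
  \<open>2 * pi\<close>.\<close>

lemma norm_one_minus_cis_ge:
  assumes "0 \<le> r" "r \<le> \<bar>t\<bar>" "\<bar>t\<bar> \<le> 2 * pi - r"
  shows "r / 2 \<le> norm (1 - cis t)"
proof -
  define s where "s = \<bar>t\<bar> / 2"
  have s: "r / 2 \<le> s" "s \<le> pi - r / 2" using assms by (auto simp: s_def)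
  have "r / 4 \<le> sin s"
  proof (cases "s \<le> pi / 2")
    case True
    with sin_ge_half[of s] s assms show ?thesis by simp
  next
    case False
    with sin_ge_half[of "pi - s"] s assms show ?thesis by simp
  qed
  moreover have "norm (1 - cis t) = 2 * \<bar>sin (t / 2)\<bar>"
    using dist_exp_i_1[of t] by (simp add: cis_conv_exp dist_norm norm_minus_commute)
  moreover have "sin s \<le> \<bar>sin (t / 2)\<bar>"
    by (simp add: s_def abs_if)
  ultimately show ?thesis by simp
qed

lemma symmetric_cos_sum_le:
  fixes D :: "nat \<Rightarrow> real \<Rightarrow> real" and n :: nat
  assumes D: "deriv_seq D" and B: "\<And>t. \<bar>D k t\<bar> \<le> B"
    and even: "\<And>t. D 0 (- t) = D 0 t" and supp: "\<And>t. \<bar>t\<bar> > 2 \<Longrightarrow> D 0 t = 0" and n: "n \<ge> 1"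
    and r: "0 \<le> r" "r \<le> \<bar>t\<bar>" "\<bar>t\<bar> \<le> 2 * pi - r"
  shows "(real n * r / 2) ^ k * \<bar>D 0 0 + 2 * (\<Sum>j=1..2*n. D 0 (real j / real n) * cos (t * real j))\<bar>
    \<le> real (4 * n + 1 + k) * B"
proof -
  let ?K = "D 0 0 + 2 * (\<Sum>j=1..2*n. D 0 (real j / real n) * cos (t * real j))"
  \<comment> \<open>Dilation gains \<open>1 / n\<close> per derivative, and the shift by 2 moves the
    support to \<open>{0..4 * n}\<close>, hence \<open>4 * n + 1\<close> coefficients.\<close>
  define E where "E k s = (1 / real n) ^ k * D k (1 / real n * s + (-2))" for k s
  have E: "deriv_seq E"
    unfolding E_def by (rule deriv_seq_affine[OF D])
  have EB: "\<bar>E k s\<bar> \<le> (1 / real n) ^ k * B" for s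
    unfolding E_def abs_mult using B by (simp add: mult_left_mono)
  have supp_E: "E 0 s = 0" if "s < 0 \<or> s \<ge> real (4 * n + 1)" for s
  proof -
    have "\<bar>1 / real n * s + (-2)\<bar> > 2"
    proof (cases "s < 0")
      case True
      then have "1 / real n * s < 0" using n by (simp add: divide_neg_pos)
      then show ?thesis by linarith
    next
      case False
      with that have "s \<ge> real (4 * n + 1)" by simp
      then have "1 / real n * s > 4" using n by (simp add: field_simps)
      then show ?thesis by linarith
    qed
    from supp[OF this] show ?thesis by (simp add: E_def)
  qed
  \<comment> \<open>The shift costs only the factor \<open>cis (t * real (2 * n))\<close> of modulus
    one.\<close>
  have "(\<Sum>j<4 * n + 1. of_real (E 0 (real j)) * cis t ^ j)
      = (\<Sum>i<2 * (2 * n) + 1. cis (t * real (2 * n)) *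
          (of_real (D 0 ((real i - real (2 * n)) / real n)) * cis (t * (real i - real (2 * n)))))"
  proof (rule sum.cong)
    fix j
    have "E 0 (real j) = D 0 ((real j - real (2 * n)) / real n)"
      using n by (simp add: E_def diff_divide_distrib)
    moreover have "cis t ^ j = cis (t * real (2 * n)) * cis (t * (real j - real (2 * n)))"
      by (simp add: Complex.DeMoivre cis_mult algebra_simps)
    ultimately show "of_real (E 0 (real j)) * cis t ^ j = cis (t * real (2 * n)) *
          (of_real (D 0 ((real j - real (2 * n)) / real n)) * cis (t * (real j - real (2 * n))))"
      by simp
  qed simp
  also have "\<dots> = cis (t * real (2 * n)) * of_real ?K"
    unfolding sum_distrib_left[symmetric]
    using symmetric_exp_sum[of "\<lambda>s. D 0 (s / real n)" "2 * n" t] even by (simp add: mult.commute)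
  finally have norm_eq: "norm (\<Sum>j<4 * n + 1. of_real (E 0 (real j)) * cis t ^ j) = \<bar>?K\<bar>"
    by (simp only: norm_mult norm_cis norm_of_real mult_1_left)
  have "(r / 2) ^ k * \<bar>?K\<bar> \<le> norm (1 - cis t) ^ k * \<bar>?K\<bar>"
    using norm_one_minus_cis_ge[OF r] r(1) by (intro mult_right_mono power_mono) auto
  also have "\<dots> \<le> real (4 * n + 1 + k) * ((1 / real n) ^ k * B)"
    using norm_exp_sum_le[OF E EB, of "4 * n + 1" "cis t"] supp_E unfolding norm_eq by simp
  finally have "real n ^ k * ((r / 2) ^ k * \<bar>?K\<bar>)
      \<le> real n ^ k * (real (4 * n + 1 + k) * ((1 / real n) ^ k * B))"
    by (rule mult_left_mono) simp
  moreover have "real n ^ k * (real (4 * n + 1 + k) * ((1 / real n) ^ k * B)) = real (4 * n + 1 + k) * B"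
    using n by (simp add: power_divide)
  moreover have "(real n * r / 2) ^ k = real n ^ k * (r / 2) ^ k"
    by (simp flip: power_mult_distrib)
  ultimately show ?thesis
    by (simp only: mult.assoc)
qed

text \<open>The order \<open>k\<close> is chosen so that each factor of the weight is at most
  \<open>1 / e\<close> times \<open>q / 2\<close>, which yields the decay
  \<open>exp (- k)\<close>.\<close>

lemma subexponential_bound:
  fixes n :: nat
  assumes \<epsilon>: "0 < \<epsilon>" "\<epsilon> \<le> 1" and r: "0 \<le> r" "r \<le> pi" and n: "n \<ge> 1"
    and bound: "\<And>k. (real n * r / 2) ^ k * X \<le> real (4 * n + 1 + k) * weight (160 / \<epsilon>) \<epsilon> k"
  shows "X \<le> 9 * exp 1 * real n * exp (- (1 / (320 * exp 1) * \<epsilon> * real n * r)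
             / (ln (exp 1 + real n * r)) powr (1 + \<epsilon>))"
proof -
  define q where "q = real n * r"
  define L where "L = ln (exp 1 + q) powr (1 + \<epsilon>)"
  \<comment> \<open>This value solves \<open>160 / \<epsilon> * w * L = q / (2 * e)\<close>.\<close>
  define w where "w = 1 / (320 * exp 1) * \<epsilon> * q / L"
  define k where "k = nat \<lfloor>w\<rfloor>"
  have q: "0 \<le> q" "q \<le> 4 * real n"
    using r n pi_less_4 by (auto simp: q_def mult.commute intro: mult_mono)
  have "1 powr (1 + \<epsilon>) \<le> L"
    unfolding L_def using ln_exp1_add_ge_1[OF q(1)] \<epsilon> by (intro powr_mono2) auto
  then have L: "1 \<le> L" by simp
  have e: "1 \<le> exp (1::real)" by simp
  have w: "0 \<le> w" using \<epsilon> q L by (simp add: w_def)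
  have "\<epsilon> * q \<le> 1 * q" using \<epsilon> q by (intro mult_right_mono) auto
  also have "\<dots> \<le> (320 * exp 1 * L) * q"
    using L e q mult_mono[OF e L] by (intro mult_right_mono) auto
  finally have wq: "w \<le> q"
    using L by (simp add: w_def field_simps)
  have k: "real k \<le> w" "w < real k + 1"
    using w by (auto simp: k_def)
  have "(q / 2) ^ k * X \<le> real (4 * n + 1 + k) * weight (160 / \<epsilon>) \<epsilon> k"
    using bound[of k] by (simp add: q_def)
  also have "weight (160 / \<epsilon>) \<epsilon> k \<le> (160 / \<epsilon> * real k * L) ^ k"
    unfolding L_def using \<epsilon> k wq by (intro weight_le_power) auto
  also have "\<dots> \<le> (q / 2 * exp (- 1)) ^ k"
  proof (rule power_mono)
    have "160 / \<epsilon> * real k * L \<le> 160 / \<epsilon> * w * L"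
      using k \<epsilon> L by (intro mult_right_mono mult_left_mono) auto
    also have "\<dots> = q / 2 * exp (- 1)"
      using \<epsilon> L by (simp add: w_def exp_minus field_simps)
    finally show "160 / \<epsilon> * real k * L \<le> q / 2 * exp (- 1)" .
  qed (use \<epsilon> L in auto)
  also have "\<dots> = (q / 2) ^ k * exp (- real k)"
    using exp_of_nat_mult[of k "- 1 :: real"] by (simp only: power_mult_distrib) simp
  finally have 1: "(q / 2) ^ k * X \<le> (q / 2) ^ k * (real (4 * n + 1 + k) * exp (- real k))"
    by (simp add: mult_ac mult_left_mono)
  \<comment> \<open>Cancellation is safe even at \<open>q = 0\<close>, since then
    \<open>k = 0\<close>.\<close>
  have "0 < (q / 2) ^ k"
  proof (cases "k = 0")
    case False
    then have "1 \<le> q" using k wq by linarith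
    then show ?thesis by simp
  qed simp
  with 1 have "X \<le> real (4 * n + 1 + k) * exp (- real k)"
    by (simp only: mult_le_cancel_left_pos)
  \<comment> \<open>Since \<open>k \<le> q \<le> 4 * n\<close>, the first factor is at most
    \<open>4 * n + n + 4 * n\<close>; rounding \<open>w\<close> down costs a factor
    \<open>e\<close>.\<close>
  also have "\<dots> \<le> (9 * real n) * exp (1 - w)"
    using k wq q n by (intro mult_mono) auto
  also have "\<dots> = 9 * exp 1 * real n * exp (- w)"
    by (simp add: exp_diff exp_minus field_simps)
  finally show ?thesis
    by (simp add: w_def q_def L_def mult.assoc)
qed

text \<open>The series stops at \<open>2 * n\<close>, and products of cosines become sums. The
  smaller normalization of \<open>cheb 0\<close> matches the single weight of \<open>f 0\<close> in
  \<open>K\<close>.\<close>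

lemma kernel_eq_symmetric_sums:
  assumes supp: "\<And>t. \<bar>t\<bar> > 2 \<Longrightarrow> f t = 0" and n: "n \<ge> 1"
  defines "K \<equiv> \<lambda>t. f 0 + 2 * (\<Sum>j=1..2*n. f (real j / real n) * cos (t * real j))"
  shows "kernel f n x y = (K (arccos x - arccos y) + K (arccos x + arccos y)) / (2 * pi)"
proof -
  let ?a = "arccos x" and ?b = "arccos y"
  have "kernel f n x y = (\<Sum>j\<in>{..2*n}. f (real j / real n) * cheb j x * cheb j y)"
    unfolding kernel_def
  proof (rule suminf_finite)
    fix j assume "j \<notin> {..2*n}"
    then have "\<bar>real j / real n\<bar> > 2" using n by (simp add: field_simps)
    then show "f (real j / real n) * cheb j x * cheb j y = 0" by (simp add: supp)
  qed simp
  also have "{..2*n} = insert 0 {1..2*n}" by auto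
  also have "(\<Sum>j\<in>insert 0 {1..2*n}. f (real j / real n) * cheb j x * cheb j y)
      = f 0 / pi + (\<Sum>j=1..2*n. f (real j / real n) * cheb j x * cheb j y)"
    by (simp add: cheb_def mult.assoc)
  also have "(\<Sum>j=1..2*n. f (real j / real n) * cheb j x * cheb j y)
      = (\<Sum>j=1..2*n. f (real j / real n) * cos ((?a - ?b) * real j) / pi
                      + f (real j / real n) * cos ((?a + ?b) * real j) / pi)"
  proof (rule sum.cong)
    fix j assume "j \<in> {1..2*n}"
    then have c: "cheb j z = sqrt (2 / pi) * cos (real j * arccos z)" for z
      by (simp add: cheb_def)
    have "cheb j x * cheb j y = (sqrt (2 / pi))\<^sup>2 * (cos (real j * ?a) * cos (real j * ?b))"
      unfolding c power2_eq_square by (simp only: mult_ac)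
    also have "\<dots> = (cos ((?a - ?b) * real j) + cos ((?a + ?b) * real j)) / pi"
      by (simp add: cos_times_cos algebra_simps add_divide_distrib)
    finally show "f (real j / real n) * cheb j x * cheb j y
      = f (real j / real n) * cos ((?a - ?b) * real j) / pi + f (real j / real n) * cos ((?a + ?b) * real j) / pi"
      by (simp add: mult.assoc add_divide_distrib distrib_left)
  qed simp
  finally show ?thesis
    unfolding K_def sum.distrib sum_divide_distrib[symmetric] by (simp add: field_simps)
qed

text \<open>Both the difference and the sum of the two angles have absolute value between
  \<open>rho x y\<close> and \<open>2 * pi - rho x y\<close>, so one bound serves both sums.\<close>

lemma kernel_subexponential:
  fixes D :: "nat \<Rightarrow> real \<Rightarrow> real" and n :: nat
  assumes \<epsilon>: "0 < \<epsilon>" "\<epsilon> \<le> 1"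
    and D: "deriv_seq D" and B: "\<And>k t. \<bar>D k t\<bar> \<le> weight (160 / \<epsilon>) \<epsilon> k"
    and even: "\<And>t. D 0 (- t) = D 0 t" and supp: "\<And>t. \<bar>t\<bar> > 2 \<Longrightarrow> D 0 t = 0"
    and n: "n \<ge> 1" and x: "x \<in> {-1..1}" and y: "y \<in> {-1..1}"
  shows "\<bar>kernel (D 0) n x y\<bar> \<le> 9 * exp 1 * real n * exp (- (1 / (320 * exp 1) * \<epsilon> * real n * rho x y)
             / (ln (exp 1 + real n * rho x y)) powr (1 + \<epsilon>))" (is "_ \<le> ?R")
proof -
  define K where "K t = D 0 0 + 2 * (\<Sum>j=1..2*n. D 0 (real j / real n) * cos (t * real j))" for t
  let ?a = "arccos x" and ?b = "arccos y"
  have ab: "0 \<le> ?a" "?a \<le> pi" "0 \<le> ?b" "?b \<le> pi"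
    using arccos_bounded[of x] arccos_bounded[of y] x y by auto
  then have rho: "0 \<le> rho x y" "rho x y \<le> pi" by (auto simp: rho_def)
  have K: "\<bar>K t\<bar> \<le> ?R" if "rho x y \<le> \<bar>t\<bar>" "\<bar>t\<bar> \<le> 2 * pi - rho x y" for t
    unfolding K_def
    by (rule subexponential_bound[OF \<epsilon> rho n])
       (rule symmetric_cos_sum_le[OF D B even supp n rho(1) that])
  have "\<bar>K (?a - ?b)\<bar> \<le> ?R" "\<bar>K (?a + ?b)\<bar> \<le> ?R"
    using ab by (intro K; simp add: rho_def abs_if)+
  then have le: "\<bar>K (?a - ?b) + K (?a + ?b)\<bar> \<le> 2 * ?R" by linarith
  have "kernel (D 0) n x y = (K (?a - ?b) + K (?a + ?b)) / (2 * pi)"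
    unfolding K_def by (rule kernel_eq_symmetric_sums[OF supp n])
  then have "\<bar>kernel (D 0) n x y\<bar> = \<bar>K (?a - ?b) + K (?a + ?b)\<bar> / (2 * pi)"
    by simp
  also have "\<dots> \<le> 2 * ?R / (2 * pi)"
    by (rule divide_right_mono[OF le]) simp
  also have "\<dots> \<le> ?R"
    using pi_gt3 mult_right_mono[of 1 pi ?R] by (simp add: divide_le_eq mult.commute)
  finally show ?thesis .
qed

subsection \<open>Cutoff functions\<close>

lemma smooth_nonneg_deriv_seq: "deriv_seq D \<Longrightarrow> smooth_nonneg (D 0)"
  unfolding smooth_nonneg_def deriv_seq_def
  by (rule exI[of _ D]) (auto intro: has_field_derivative_at_within)

lemma exists_log_bump:
  assumes "0 < \<epsilon>"
  shows "\<exists>D. deriv_seq D \<and> (\<forall>k t. \<bar>D k t\<bar> \<le> weight (16 / \<epsilon>) \<epsilon> k) \<and> (\<forall>t. D 0 (- t) = D 0 t)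
     \<and> (\<forall>t. \<bar>t\<bar> \<le> 1 \<longrightarrow> D 0 t = 1) \<and> (\<forall>t. \<bar>t\<bar> \<ge> 2 \<longrightarrow> D 0 t = 0)"
proof -
  have "weight (16 / \<epsilon>) \<epsilon> k = (\<Prod>j<k. 2 / (\<epsilon> / (8 * (real (Suc j) * logw \<epsilon> j))))" for k
    unfolding weight_def using assms by (intro prod.cong) auto
  then show ?thesis
    using box_widths.exists_bump[OF box_widths_log[OF assms]] by simp
qed

lemma exists_type_a:
  assumes "0 < \<epsilon>"
  shows "\<exists>D. deriv_seq D \<and> (\<forall>k t. \<bar>D k t\<bar> \<le> weight (160 / \<epsilon>) \<epsilon> k) \<and> (\<forall>t. D 0 (- t) = D 0 t)
     \<and> (\<forall>t. \<bar>t\<bar> > 2 \<longrightarrow> D 0 t = 0) \<and> admissible_a (D 0)"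
proof -
  obtain D where D: "deriv_seq D" "\<And>k t. \<bar>D k t\<bar> \<le> weight (16 / \<epsilon>) \<epsilon> k" "\<And>t. D 0 (- t) = D 0 t"
     "\<And>t. \<bar>t\<bar> \<le> 1 \<Longrightarrow> D 0 t = 1" "\<And>t. \<bar>t\<bar> \<ge> 2 \<Longrightarrow> D 0 t = 0"
    using exists_log_bump[OF assms] by blast
  have "weight (16 / \<epsilon>) \<epsilon> k \<le> weight (160 / \<epsilon>) \<epsilon> k" for k
    using assms by (intro weight_mono) (auto simp: divide_right_mono)
  with D(2) have "\<bar>D k t\<bar> \<le> weight (160 / \<epsilon>) \<epsilon> k" for k t
    using order_trans by blast
  with D smooth_nonneg_deriv_seq[OF D(1)] show ?thesis
    by (intro exI[of _ D]) (auto simp: admissible_a_def)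
qed

text \<open>For \<open>t\<close> in \<open>{1..2}\<close> the values at \<open>t\<close> and
  \<open>t / 2\<close> are the sine and cosine of \<open>pi / 2 * D 0 t\<close>. The constant 16
  doubles by the dilation, and the factor 4 in the bound for \<open>G\<close> multiplies it by
  \<open>4 + 1\<close>, giving 160.\<close>

lemma exists_type_c:
  assumes "0 < \<epsilon>"
  shows "\<exists>D. deriv_seq D \<and> (\<forall>k t. \<bar>D k t\<bar> \<le> weight (160 / \<epsilon>) \<epsilon> k) \<and> (\<forall>t. D 0 (- t) = D 0 t)
     \<and> (\<forall>t. \<bar>t\<bar> > 2 \<longrightarrow> D 0 t = 0) \<and> admissible_c (D 0)"
proof -
  obtain D where D: "deriv_seq D" "\<And>k t. \<bar>D k t\<bar> \<le> weight (16 / \<epsilon>) \<epsilon> k" "\<And>t. D 0 (- t) = D 0 t"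
     "\<And>t. \<bar>t\<bar> \<le> 1 \<Longrightarrow> D 0 t = 1" "\<And>t. \<bar>t\<bar> \<ge> 2 \<Longrightarrow> D 0 t = 0"
    using exists_log_bump[OF assms] by blast
  \<comment> \<open>The sign is reversed because phase 1 gives \<open>cos (G 0 t + pi / 2)\<close>,
    that is, minus the sine; \<open>+ 0\<close> fits the affine form.\<close>
  define G where "G k t = pi / 2 * (2 ^ k * D k (2 * t + 0) - D k t)" for k t
  define E where "E = cos_derivs G 1"
  have G: "deriv_seq G"
    unfolding G_def by (intro deriv_seq_cmult deriv_seq_diff deriv_seq_affine D(1))
  have E: "deriv_seq E"
    unfolding deriv_seq_def E_def using cos_derivs_has_derivative[OF G] by blast
  have E0: "E 0 t = sin (pi / 2 * (D 0 t - D 0 (2 * t)))" for t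
  proof -
    have "E 0 t = cos (pi / 2 * (D 0 (2 * t) - D 0 t) + pi / 2)"
      by (simp add: E_def G_def)
    also have "\<dots> = - sin (pi / 2 * (D 0 (2 * t) - D 0 t))"
      by (simp only: cos_add cos_pi_half sin_pi_half)
    also have "\<dots> = sin (pi / 2 * (D 0 t - D 0 (2 * t)))"
      by (metis minus_diff_eq mult_minus_right sin_minus)
    finally show ?thesis .
  qed
  have G_le: "\<bar>G k t\<bar> \<le> 4 * weight (32 / \<epsilon>) \<epsilon> k" for k t
  proof -
    let ?W = "weight (16 / \<epsilon>) \<epsilon> k"
    have W: "0 \<le> ?W" using assms by (simp add: weight_nonneg)
    have "\<bar>2 ^ k * D k (2 * t + 0) - D k t\<bar> \<le> 2 ^ k * \<bar>D k (2 * t + 0)\<bar> + 1 * \<bar>D k t\<bar>"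
      using abs_triangle_ineq4[of "2 ^ k * D k (2 * t + 0)" "D k t"] by (simp add: abs_mult)
    also have "\<dots> \<le> 2 ^ k * ?W + 2 ^ k * ?W"
      using W by (intro add_mono mult_mono D(2)) auto
    finally have "\<bar>G k t\<bar> \<le> pi / 2 * (2 * (2 ^ k * ?W))"
      unfolding G_def abs_mult by (intro mult_mono) auto
    also have "\<dots> \<le> 4 / 2 * (2 * (2 ^ k * ?W))"
      using W pi_less_4 by (intro mult_right_mono) auto
    also have "\<dots> = 4 * weight (32 / \<epsilon>) \<epsilon> k"
      by (simp add: weight_scale)
    finally show ?thesis .
  qed
  have "\<bar>E k t\<bar> \<le> (4 + 1) ^ k * weight (32 / \<epsilon>) \<epsilon> k" for k t
    unfolding E_def using assms
    by (intro abs_cos_derivs_le weight_mult_le weight_nonneg G_le) (auto simp: weight_def)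
  then have EB: "\<bar>E k t\<bar> \<le> weight (160 / \<epsilon>) \<epsilon> k" for k t
    by (simp add: weight_scale)
  have outer: "E 0 t = 0" if "\<bar>t\<bar> \<ge> 2 \<or> \<bar>t\<bar> \<le> 1 / 2" for t
    using that D(4,5)[of t] D(4,5)[of "2 * t"] by (auto simp: E0)
  have "\<bar>E 0 t\<bar>\<^sup>2 + \<bar>E 0 (t / 2)\<bar>\<^sup>2 = 1" if t: "t \<in> {1..2}" for t
  proof -
    have "E 0 t = sin (pi / 2 * D 0 t)"
      using D(5)[of "2 * t"] t by (simp add: E0)
    moreover have "E 0 (t / 2) = sin (pi / 2 - pi / 2 * D 0 t)"
      using D(4)[of "t / 2"] t by (simp add: E0 right_diff_distrib)
    ultimately show ?thesis by (simp add: sin_diff)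
  qed
  then have "admissible_c (E 0)"
    using outer smooth_nonneg_deriv_seq[OF E] by (auto simp: admissible_c_def)
  moreover have "E 0 (- t) = E 0 t" for t
    using D(3)[of t] D(3)[of "2 * t"] by (simp add: E0)
  ultimately show ?thesis
    using E EB outer by (intro exI[of _ E]) auto
qed

text \<open>Type (c) implies type (b), so two constructions cover the three types.\<close>

lemma exists_admissible:
  assumes "0 < \<epsilon>" "adm \<in> {admissible_a, admissible_b, admissible_c}"
  shows "\<exists>D. deriv_seq D \<and> (\<forall>k t. \<bar>D k t\<bar> \<le> weight (160 / \<epsilon>) \<epsilon> k) \<and> (\<forall>t. D 0 (- t) = D 0 t)
     \<and> (\<forall>t. \<bar>t\<bar> > 2 \<longrightarrow> D 0 t = 0) \<and> adm (D 0)"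
proof -
  have "admissible_c f \<Longrightarrow> admissible_b f" for f
    by (simp add: admissible_b_def admissible_c_def)
  then show ?thesis
    using exists_type_a[OF assms(1)] exists_type_c[OF assms(1)] assms(2) by blast
qed

theorem theorem2p1:
  shows "\<exists>c'>0. \<forall>\<epsilon>::real. 0 < \<epsilon> \<and> \<epsilon> \<le> 1 \<longrightarrow>
    (\<forall>adm \<in> {admissible_a, admissible_b, admissible_c}.
      \<exists>f c. adm f \<and> c > 0 \<and>
        (\<forall>n::nat. n \<ge> 1 \<longrightarrow> (\<forall>x\<in>{-1..1}. \<forall>y\<in>{-1..1}.
          \<bar>kernel f n x y\<bar> \<le> c * real n * exp (- (c' * \<epsilon> * real n * rho x y)
             / (ln (exp 1 + real n * rho x y)) powr (1 + \<epsilon>)))))"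
proof (intro exI[of _ "1 / (320 * exp 1)"] conjI allI impI ballI)
  show "0 < 1 / (320 * exp (1::real))" by simp
next
  fix \<epsilon> :: real and adm
  assume \<epsilon>: "0 < \<epsilon> \<and> \<epsilon> \<le> 1" and adm: "adm \<in> {admissible_a, admissible_b, admissible_c}"
  then obtain D where D: "deriv_seq D" "\<And>k t. \<bar>D k t\<bar> \<le> weight (160 / \<epsilon>) \<epsilon> k"
      "\<And>t. D 0 (- t) = D 0 t" "\<And>t. \<bar>t\<bar> > 2 \<Longrightarrow> D 0 t = 0" and "adm (D 0)"
    using exists_admissible[of \<epsilon> adm] by blast
  then show "\<exists>f c. adm f \<and> c > 0 \<and>
        (\<forall>n::nat. n \<ge> 1 \<longrightarrow> (\<forall>x\<in>{-1..1}. \<forall>y\<in>{-1..1}.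
          \<bar>kernel f n x y\<bar> \<le> c * real n * exp (- (1 / (320 * exp 1) * \<epsilon> * real n * rho x y)
             / (ln (exp 1 + real n * rho x y)) powr (1 + \<epsilon>))))"
    \<comment> \<open>The constant \<open>9 * exp 1\<close> does not even depend on
      \<epsilon>.\<close>
    using \<epsilon> by (intro exI[of _ "D 0"] exI[of _ "9 * exp 1"] conjI allI impI ballI
        kernel_subexponential[OF _ _ D]) auto
qed

end
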